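(* Let $G$ be a graph, $v$ a node, and let $\pi_1,\pi_2,\dots$ be independent random paths, each obtained by choosing two nodes $s,t$ uniformly at random and then a shortest $s$–$t$ path uniformly at random; let $X_i=1$ if $v$ is an internal node of $\pi_i$ and $X_i=0$ otherwise, so that $\mathbb E[X_i]=b(v)$. Let $\omega>0$ be fixed and let $\tau$ be a positive integer-valued random variable with $\tau\le\omega$ such that the event $\{\tau=t\}$ is determined by $\pi_1,\dots,\pi_t$, and set $\tilde b(v)=\frac1\tau\sum_{i=1}^\tau X_i$. Then for all fixed real numbers $\delta_L,\delta_U\in(0,1)$, $\Pr\big(b(v)\le \tilde b(v)-f(\tilde b(v),\delta_L,\omega,\tau)\big)\le\delta_L$ and $\Pr\big(b(v)\ge\tilde b(v)+g(\tilde b(v),\delta_U,\omega,\tau)\big)\le\delta_U$, where $f(\tilde b,\delta_L,\omega,\tau)=\frac{1}{\tau}\log\frac{1}{\delta_L}\Big(\frac13-\frac{\omega}{\tau}+\sqrt{(\frac13-\frac{\omega}{\tau})^2+\frac{2\tilde b\omega}{\log(1/\delta_L)}}\Big)$ and $g(\tilde b,\delta_U,\omega,\tau)=\frac{1}{\tau}\log\frac{1}{\delta_U}\Big(\frac13+\frac{\omega}{\tau}+\sqrt{(\frac13+\frac{\omega}{\tau})^2+\frac{2\tilde b\omega}{\log(1/\delta_U)}}\Big)$.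
   Context: The normalized betweenness centrality of $v$ in a graph with $n$ nodes is $b(v)=\frac{1}{n(n-1)}\sum_{s\ne v\ne t}\frac{\sigma_{st}(v)}{\sigma_{st}}$, where $\sigma_{st}$ is the number of shortest $s$–$t$ paths and $\sigma_{st}(v)$ the number of those passing through $v$.
   Formalization: The first inequality is stated only for b(v) > 0: if b(v) = 0 then the estimate and f are both 0 almost surely, so the event has probability 1 > δ_L. The graph has at least two nodes, and s, t are a uniform ordered pair of distinct nodes. *)

theory Defs
  imports "HOL-Probability.Probability" "Graph_Theory.Kuratowski"
begin

text \<open>
  Directed and undirected unweighted graphs are treated uniformly: undirected graphs are the
  symmetric digraphs (locale \<^locale>\<open>graph\<close>). Paths are arc lists; as there are no parallel arcs
  in a \<^locale>\<open>digraph\<close>, they correspond to node sequences.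
\<close>

definition shortest_paths :: "('a, 'b) pre_digraph \<Rightarrow> 'a \<Rightarrow> 'a \<Rightarrow> 'b awalk set" where
  "shortest_paths G s t =
     {p. pre_digraph.apath G s p t \<and> (\<forall>q. pre_digraph.apath G s q t \<longrightarrow> length p \<le> length q)}"

definition num_shortest :: "('a, 'b) pre_digraph \<Rightarrow> 'a \<Rightarrow> 'a \<Rightarrow> nat" where
  "num_shortest G s t = card (shortest_paths G s t)"

definition num_shortest_through :: "('a, 'b) pre_digraph \<Rightarrow> 'a \<Rightarrow> 'a \<Rightarrow> 'a \<Rightarrow> nat" where
  "num_shortest_through G s t v =
     card {p \<in> shortest_paths G s t. v \<in> set (pre_digraph.awalk_verts G s p)}"

text \<open>
  Pairs without a connecting path contribute \<open>0 / 0 = 0\<close>; so does the diagonal \<open>s = t\<close>, where the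
  only shortest path is the empty one, which misses \<open>v\<close>.
\<close>

definition betweenness :: "('a, 'b) pre_digraph \<Rightarrow> 'a \<Rightarrow> real" where
  "betweenness G v =
     1 / (real (card (verts G)) * (real (card (verts G)) - 1)) *
     (\<Sum>s \<in> verts G - {v}. \<Sum>t \<in> verts G - {v}.
        real (num_shortest_through G s t v) / real (num_shortest G s t))"

text \<open>
  The two nodes are an ordered pair of distinct nodes, in accordance with the normalisation
  \<open>n (n - 1)\<close>. If there is no path from \<open>s\<close> to \<open>t\<close>, the sample is the empty arc list, which has no
  internal node and is not a path between distinct nodes.
\<close>

definition random_path :: "('a, 'b) pre_digraph \<Rightarrow> 'b awalk pmf" where
  "random_path G =
     bind_pmf (pmf_of_set {(s, t). s \<in> verts G \<and> t \<in> verts G \<and> s \<noteq> t})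
       (\<lambda>(s, t). if shortest_paths G s t = {} then return_pmf []
                 else pmf_of_set (shortest_paths G s t))"

definition hit :: "('a, 'b) pre_digraph \<Rightarrow> 'a \<Rightarrow> 'b awalk \<Rightarrow> real" where
  "hit G v p = (if v \<in> set (pre_digraph.inner_verts G p) then 1 else 0)"

definition empirical_betweenness ::
  "('a, 'b) pre_digraph \<Rightarrow> 'a \<Rightarrow> (nat \<Rightarrow> 'b awalk) \<Rightarrow> nat \<Rightarrow> real" where
  "empirical_betweenness G v ps k = 1 / real k * (\<Sum>i = 1..k. hit G v (ps i))"

definition lower_dev :: "real \<Rightarrow> real \<Rightarrow> real \<Rightarrow> nat \<Rightarrow> real" where
  "lower_dev b \<delta> \<omega> k =
     1 / real k * ln (1 / \<delta>) *
     (1 / 3 - \<omega> / real k + sqrt ((1 / 3 - \<omega> / real k)\<^sup>2 + 2 * b * \<omega> / ln (1 / \<delta>)))"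

definition upper_dev :: "real \<Rightarrow> real \<Rightarrow> real \<Rightarrow> nat \<Rightarrow> real" where
  "upper_dev b \<delta> \<omega> k =
     1 / real k * ln (1 / \<delta>) *
     (1 / 3 + \<omega> / real k + sqrt ((1 / 3 + \<omega> / real k)\<^sup>2 + 2 * b * \<omega> / ln (1 / \<delta>)))"

text \<open>
  The lower deviation vanishes at a zero estimate. Hence, for a node of betweenness \<open>0\<close>, the event
  \<open>b \<le> b' - f\<close> (with \<open>b'\<close> the estimate) reads \<open>0 \<le> 0\<close> and has probability \<open>1\<close>; the lower tail
  bound with a non-strict inequality therefore requires positive betweenness.
\<close>

lemma lower_dev_zero:
  assumes "0 < k" "real k \<le> \<omega>"
  shows "lower_dev 0 \<delta> \<omega> k = 0"
proof -
  have "1 \<le> \<omega> / real k" using assms by (simp add: field_simps)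
  then have "sqrt ((1 / 3 - \<omega> / real k)\<^sup>2) = - (1 / 3 - \<omega> / real k)" by simp
  then show ?thesis unfolding lower_dev_def by simp
qed

lemma (in fin_digraph) finite_shortest_paths: "finite (shortest_paths G s t)"
  by (rule finite_subset[OF _ apaths_finite[of s t]]) (auto simp: shortest_paths_def)

lemma (in wf_digraph) apath_inner_verts_iff:
  assumes "apath s p t" "s \<noteq> t"
  shows "v \<in> set (inner_verts p) \<longleftrightarrow> v \<in> set (awalk_verts s p) \<and> v \<noteq> s \<and> v \<noteq> t"
proof -
  have *: "awalk_verts u q = map (tail G) q @ [w]" if "cas u q w" for u q w
    using that by (induction q arbitrary: u) auto
  have c: "cas s p t" and d: "distinct (awalk_verts s p)"
    using assms(1) by (auto simp: apath_def awalk_def)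
  obtain e es where p: "p = e # es" using c assms(2) by (cases p) auto
  show ?thesis using *[OF c] d c by (fastforce simp: p inner_verts_def)
qed

lemma (in digraph) expectation_hit:
  assumes n: "2 \<le> card (verts G)"
  shows "measure_pmf.expectation (random_path G) (hit G v) = betweenness G v"
proof -
  let ?n = "real (card (verts G))"
  let ?P = "{(s, t). s \<in> verts G \<and> t \<in> verts G \<and> s \<noteq> t}"
  let ?r = "\<lambda>s t. real (num_shortest_through G s t v) / real (num_shortest G s t)"
  let ?k = "\<lambda>(s, t). if shortest_paths G s t = {} then return_pmf []
                 else pmf_of_set (shortest_paths G s t)"
  have P: "?P = (verts G \<times> verts G) - (\<lambda>s. (s, s)) ` verts G" by auto
  have fP: "finite ?P" unfolding P by simp
  have "card ?P = card (verts G) * card (verts G) - card (verts G)"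
    unfolding P by (subst card_Diff_subset) (auto simp: card_image inj_on_def card_cartesian_product)
  then have cP: "real (card ?P) = ?n * (?n - 1)"
    by (simp add: of_nat_diff algebra_simps)
  have "real (card ?P) > 0" unfolding cP using n by simp
  then have neP: "?P \<noteq> {}" by (metis card.empty of_nat_0 less_irrefl)
  have inner: "measure_pmf.expectation (?k (s, t)) (hit G v) = (if s \<noteq> v \<and> t \<noteq> v then ?r s t else 0)"
    if "(s, t) \<in> ?P" for s t
  proof (cases "shortest_paths G s t = {}")
    case True
    then show ?thesis by (simp add: hit_def num_shortest_def num_shortest_through_def)
  next
    case False
    have h: "hit G v p = (if s \<noteq> v \<and> t \<noteq> v \<and> v \<in> set (awalk_verts s p) then 1 else 0)"
      if "p \<in> shortest_paths G s t" for p
      using apath_inner_verts_iff[of s p t v] that \<open>(s, t) \<in> ?P\<close>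
      by (auto simp: hit_def shortest_paths_def)
    have "measure_pmf.expectation (?k (s, t)) (hit G v)
        = (\<Sum>p\<in>shortest_paths G s t. hit G v p) / real (card (shortest_paths G s t))"
      using False by (simp add: integral_pmf_of_set finite_shortest_paths)
    also have "(\<Sum>p\<in>shortest_paths G s t. hit G v p)
        = (\<Sum>p\<in>shortest_paths G s t. if s \<noteq> v \<and> t \<noteq> v \<and> v \<in> set (awalk_verts s p) then 1 else 0)"
      by (rule sum.cong) (simp_all only: h)
    also have "\<dots> = (if s \<noteq> v \<and> t \<noteq> v then real (num_shortest_through G s t v) else 0)"
      by (auto simp: num_shortest_through_def finite_shortest_paths simp flip: sum.inter_filter)
    finally show ?thesis by (simp add: num_shortest_def)
  qed
  have diag: "?r s s = 0" if "s \<noteq> v" for s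
  proof -
    have "p = []" if p: "p \<in> shortest_paths G s s" for p
    proof -
      have "apath s [] s" using p by (auto simp: shortest_paths_def apath_def awalk_def)
      then have "length p \<le> length ([] :: 'b list)" using p unfolding shortest_paths_def by blast
      then show ?thesis by simp
    qed
    then have "{p \<in> shortest_paths G s s. v \<in> set (awalk_verts s p)} = {}"
      using that by force
    then have "num_shortest_through G s s v = 0"
      unfolding num_shortest_through_def by (metis card.empty)
    then show ?thesis by simp
  qed
  have "measure_pmf.expectation (random_path G) (hit G v)
      = (\<Sum>x\<in>?P. measure_pmf.expectation (?k x) (hit G v)) / real (card ?P)"
    unfolding random_path_def
    by (subst pmf_expectation_bind_pmf_of_set[OF neP fP])
       (auto simp: finite_shortest_paths sum_divide_distrib divide_inverse sum_distrib_left mult.commute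
          split: if_splits)
  also have "(\<Sum>x\<in>?P. measure_pmf.expectation (?k x) (hit G v))
      = (\<Sum>(s, t)\<in>?P. if s \<noteq> v \<and> t \<noteq> v then ?r s t else 0)"
    using inner by (intro sum.cong) auto
  also have "\<dots> = (\<Sum>(s, t)\<in>(verts G - {v}) \<times> (verts G - {v}). ?r s t)"
    by (rule sum.mono_neutral_cong) (use diag fP in \<open>auto split: if_splits\<close>)
  also have "\<dots> = (\<Sum>s\<in>verts G - {v}. \<Sum>t\<in>verts G - {v}. ?r s t)"
    by (simp add: sum.cartesian_product)
  finally show ?thesis by (simp add: betweenness_def cP)
qed

end

theory Submission
  imports Defs
begin

text \<open>
  Put \<open>l = log (1 / \<delta>)\<close>. Bernstein's inequality at the stopping time \<open>\<tau> \<le> \<omega>\<close>, proved with the stopped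
  exponential supermartingale and Markov's inequality, says that \<open>X\<^sub>1 + \<dots> + X\<^sub>\<tau>\<close> deviates from \<open>\<tau> b\<close> by
  at least \<open>r\<close> with probability at most \<open>\<delta>\<close>, in either direction, where \<open>r\<close> is the positive root of
  \<open>r\<^sup>2 = 2 l (\<omega> b + r / 3)\<close>. Both events of the theorem say that the actual deviation \<open>d\<close> is at least
  the root of the analogous equation with the estimate in place of \<open>b\<close>. As the estimate differs from
  \<open>b\<close> by \<open>\<plusminus> d / \<tau>\<close>, shifting the linear coefficient \<open>1 / 3\<close> by \<open>\<plusminus> \<omega> / \<tau>\<close> turns one
  equation into the other.
\<close>

section \<open>Bernstein's moment bound\<close>

lemma two_mult_power3_le_fact: "2 * 3 ^ n \<le> (fact (n + 2) :: real)"
proof (induction n)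
  case (Suc n)
  have "2 * 3 ^ Suc n \<le> 3 * (fact (n + 2) :: real)"
    using Suc unfolding power_Suc by linarith
  also have "\<dots> \<le> (real n + 3) * fact (n + 2)" by (intro mult_right_mono) auto
  also have "\<dots> = fact (Suc n + 2)" by (simp add: algebra_simps)
  finally show ?case .
qed simp

lemma exp_minus_linear_le:
  fixes x :: real
  assumes "\<bar>x\<bar> < 3"
  shows "exp x - 1 - x \<le> x\<^sup>2 / (2 * (1 - \<bar>x\<bar> / 3))"
proof -
  have geo: "(\<lambda>n. (x\<^sup>2 / 2) * (\<bar>x\<bar> / 3) ^ n) sums ((x\<^sup>2 / 2) * (1 / (1 - \<bar>x\<bar> / 3)))"
    using assms by (intro sums_mult geometric_sums) auto
  have "exp x - 1 - x = (\<Sum>n. inverse (fact (n + 2)) *\<^sub>R (x ^ (n + 2)))"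
    using exp_first_two_terms[of x] by simp
  also have "\<dots> \<le> (\<Sum>n. (x\<^sup>2 / 2) * (\<bar>x\<bar> / 3) ^ n)"
  proof (rule suminf_le)
    fix n
    have "inverse (fact (n + 2)) *\<^sub>R x ^ (n + 2) \<le> inverse (fact (n + 2)) * \<bar>x\<bar> ^ (n + 2)"
      unfolding real_scaleR_def
      by (intro mult_left_mono) (simp_all add: power_abs[symmetric] del: power_Suc fact_Suc)
    also have "\<dots> \<le> inverse (2 * 3 ^ n) * \<bar>x\<bar> ^ (n + 2)"
      by (intro mult_right_mono le_imp_inverse_le two_mult_power3_le_fact) auto
    also have "\<dots> = (x\<^sup>2 / 2) * (\<bar>x\<bar> / 3) ^ n"
      by (simp add: field_simps power_add power2_eq_square)
    finally show "inverse (fact (n + 2)) *\<^sub>R x ^ (n + 2) \<le> (x\<^sup>2 / 2) * (\<bar>x\<bar> / 3) ^ n" .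
  next
    show "summable (\<lambda>n. inverse (fact (n + 2)) *\<^sub>R x ^ (n + 2))"
      using summable_exp_generic[of x] by (subst summable_iff_shift)
  qed (use geo in \<open>auto simp: sums_iff\<close>)
  also have "\<dots> = x\<^sup>2 / (2 * (1 - \<bar>x\<bar> / 3))"
    using geo by (simp add: sums_iff)
  finally show ?thesis .
qed

definition bernstein_cgf :: "real \<Rightarrow> real \<Rightarrow> real" where
  "bernstein_cgf c \<theta> = \<theta>\<^sup>2 / (2 * (1 - c * \<theta> / 3))"

lemma bernstein_cgf_nonneg: "c * \<theta> < 3 \<Longrightarrow> 0 \<le> bernstein_cgf c \<theta>"
  unfolding bernstein_cgf_def by (intro divide_nonneg_pos) (simp_all add: mult.commute)

lemma exp_mult_le_bernstein_cgf:
  assumes "\<bar>y\<bar> \<le> c" "0 \<le> \<theta>" "c * \<theta> < 3"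
  shows "exp (\<theta> * y) \<le> 1 + \<theta> * y + bernstein_cgf c \<theta> * y\<^sup>2"
proof -
  have abs_le: "\<bar>\<theta> * y\<bar> \<le> c * \<theta>"
    using mult_left_mono[OF assms(1,2)] assms(2) by (simp add: abs_mult mult.commute)
  have "exp (\<theta> * y) - 1 - \<theta> * y \<le> (\<theta> * y)\<^sup>2 / (2 * (1 - \<bar>\<theta> * y\<bar> / 3))"
    using abs_le assms(3) by (intro exp_minus_linear_le) linarith
  also have "\<dots> \<le> (\<theta> * y)\<^sup>2 / (2 * (1 - c * \<theta> / 3))"
    using abs_le assms(3) by (intro divide_left_mono mult_pos_pos) (simp_all add: mult.commute)
  finally show ?thesis by (simp add: bernstein_cgf_def power_mult_distrib)
qed

text \<open>The exponent \<open>\<theta>\<close> is not the exact optimum in Chernoff's bound, but the one with a closed form.\<close>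

lemma bernstein_exponent_eq:
  fixes V c r :: real
  assumes "0 < V" "0 \<le> c" "0 \<le> r"
  defines "\<theta> \<equiv> r / (V + c * r / 3)"
  shows "0 \<le> \<theta>" and "c * \<theta> < 3"
    and "\<theta> * r - V * bernstein_cgf c \<theta> = r\<^sup>2 / (2 * (V + c * r / 3))"
proof -
  define W where "W = V + c * r / 3"
  have W: "0 < W" using assms(1-3) by (simp add: W_def add_pos_nonneg)
  show "0 \<le> \<theta>" using W assms(3) by (simp add: \<theta>_def flip: W_def)
  have "c * r < 3 * W" using assms(1) by (simp add: W_def)
  then show "c * \<theta> < 3" using W by (simp add: \<theta>_def field_simps flip: W_def)
  have "1 - c * \<theta> / 3 = V / W" using W by (simp add: \<theta>_def field_simps W_def)
  then have "V * bernstein_cgf c \<theta> = \<theta>\<^sup>2 * W / 2"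
    using assms(1) by (simp add: bernstein_cgf_def)
  also have "\<theta>\<^sup>2 * W = r\<^sup>2 / W"
    using W by (simp add: \<theta>_def power2_eq_square flip: W_def)
  finally show "\<theta> * r - V * bernstein_cgf c \<theta> = r\<^sup>2 / (2 * (V + c * r / 3))"
    by (simp add: \<theta>_def power2_eq_square flip: W_def)
qed

lemma (in prob_space) expectation_exp_le_bernstein_cgf:
  fixes Y :: "'a \<Rightarrow> real"
  assumes Y [measurable]: "random_variable borel Y" and bound: "AE x in M. \<bar>Y x\<bar> \<le> c"
    and mean: "expectation Y = 0" and second_moment: "expectation (\<lambda>x. (Y x)\<^sup>2) \<le> s"
    and \<theta>: "0 \<le> \<theta>" "c * \<theta> < 3"
  shows "expectation (\<lambda>x. exp (\<theta> * Y x)) \<le> exp (s * bernstein_cgf c \<theta>)"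
proof -
  define \<psi> where "\<psi> = bernstein_cgf c \<theta>"
  have exp_le: "AE x in M. exp (\<theta> * Y x) \<le> 1 + \<theta> * Y x + \<psi> * (Y x)\<^sup>2"
    using bound by eventually_elim (simp add: \<psi>_def exp_mult_le_bernstein_cgf \<theta>)
  have "AE x in M. norm (Y x) \<le> c" using bound by simp
  then have int_Y: "integrable M Y" by (rule integrable_const_bound) fact
  have "AE x in M. norm ((Y x)\<^sup>2) \<le> c\<^sup>2"
    using bound by eventually_elim (simp add: abs_le_square_iff[symmetric])
  then have int_Y2: "integrable M (\<lambda>x. (Y x)\<^sup>2)" by (rule integrable_const_bound) measurable
  have "AE x in M. norm (exp (\<theta> * Y x)) \<le> exp (\<theta> * c)"
    using bound by eventually_elim (use \<theta>(1) in \<open>simp add: mult_left_mono\<close>)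
  then have int_exp: "integrable M (\<lambda>x. exp (\<theta> * Y x))" by (rule integrable_const_bound) measurable
  have "expectation (\<lambda>x. exp (\<theta> * Y x)) \<le> expectation (\<lambda>x. 1 + \<theta> * Y x + \<psi> * (Y x)\<^sup>2)"
    using exp_le int_exp int_Y int_Y2 by (intro integral_mono_AE) auto
  also have "\<dots> = 1 + \<psi> * expectation (\<lambda>x. (Y x)\<^sup>2)"
    using int_Y int_Y2 by (simp add: mean prob_space)
  also have "\<dots> \<le> 1 + s * \<psi>"
    using mult_left_mono[OF second_moment bernstein_cgf_nonneg[OF \<theta>(2)]]
    by (simp add: \<psi>_def mult.commute)
  also have "\<dots> \<le> exp (s * \<psi>)" by (rule exp_ge_add_one_self)
  finally show ?thesis by (simp add: \<psi>_def)
qed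

lemma (in prob_space) variance_unit_interval_le:
  fixes Y :: "'a \<Rightarrow> real"
  assumes Y [measurable]: "random_variable borel Y" and unit: "AE x in M. 0 \<le> Y x \<and> Y x \<le> 1"
  shows "variance Y \<le> expectation Y"
proof -
  have "AE x in M. norm (Y x) \<le> 1" using unit by eventually_elim auto
  then have int_Y: "integrable M Y" by (rule integrable_const_bound) fact
  have square_le: "AE x in M. (Y x)\<^sup>2 \<le> Y x"
    using unit by eventually_elim (simp add: power2_eq_square mult_left_le)
  have "AE x in M. norm ((Y x)\<^sup>2) \<le> 1" using unit by eventually_elim (auto simp: power_le_one)
  then have int_Y2: "integrable M (\<lambda>x. (Y x)\<^sup>2)" by (rule integrable_const_bound) measurable
  have "variance Y \<le> expectation (\<lambda>x. (Y x)\<^sup>2)"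
    by (simp add: variance_eq[OF int_Y int_Y2])
  also have "\<dots> \<le> expectation Y" using int_Y2 int_Y square_le by (rule integral_mono_AE)
  finally show ?thesis .
qed

section \<open>Independence of a countably supported past\<close>

lemma (in prob_space) indep_var_cong_AE:
  assumes indep: "indep_var S X T Y"
    and X': "random_variable S X'" "AE x in M. X x = X' x"
    and Y': "random_variable T Y'" "AE x in M. Y x = Y' x"
  shows "indep_var S X' T Y'"
proof -
  note [measurable] = X'(1) Y'(1) indep_var_rv1[OF indep] indep_var_rv2[OF indep]
  have "distr M S X = distr M S X'" "distr M T Y = distr M T Y'"
    using X' Y' by (auto intro!: distr_cong_AE)
  moreover have "distr M (S \<Otimes>\<^sub>M T) (\<lambda>x. (X x, Y x)) = distr M (S \<Otimes>\<^sub>M T) (\<lambda>x. (X' x, Y' x))"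
    using X'(2) Y'(2) by (intro distr_cong_AE) (auto elim!: eventually_elim2)
  ultimately show ?thesis
    using indep by (simp add: indep_var_distribution_eq)
qed

lemma measurable_If_countable:
  assumes "countable C" "\<And>x. x \<in> C \<Longrightarrow> {x} \<in> sets K" "\<And>x. x \<in> C \<Longrightarrow> f x \<in> space N" "z \<in> space N"
  shows "(\<lambda>x. if x \<in> C then f x else z) \<in> measurable K N"
proof (rule measurable_restrict_countable[OF assms(1,2)])
  show "(\<lambda>x. if x \<in> C then f x else z) \<in> measurable (restrict_space K (- C)) N"
    using assms(4) by (subst measurable_cong[where g = "\<lambda>_. z"]) (auto simp: space_restrict_space)
qed (use assms(3) in auto)

lemma sets_PiM_count_space_singleton:
  assumes "finite J" "f \<in> extensional J"
  shows "{f} \<in> sets (PiM J (\<lambda>_. count_space UNIV))"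
proof -
  have "PiE J (\<lambda>i. {f i}) \<in> sets (PiM J (\<lambda>_. count_space UNIV))"
    using assms(1) by (intro sets_PiM_I_finite) auto
  then show ?thesis using assms(2) by (simp add: PiE_singleton)
qed

text \<open>
  Although \<open>f\<close> need not be measurable, it agrees almost surely with a function supported on
  countably many points.
\<close>

lemma (in prob_space) indep_var_function_of_countable_past:
  fixes X :: "'i \<Rightarrow> 'a \<Rightarrow> 'c"
  assumes indep: "indep_vars (\<lambda>_. count_space UNIV) X I"
    and J: "finite J" "J \<subseteq> I" and k: "k \<in> I - J"
    and S: "countable S" "\<And>i. i \<in> J \<Longrightarrow> AE x in M. X i x \<in> S"
    and Z: "random_variable N Z" "AE x in M. Z x = f (restrict (\<lambda>i. X i x) J)"
    and g: "g \<in> measurable (count_space UNIV) L"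
  shows "indep_var N Z L (\<lambda>x. g (X k x))"
proof -
  define past where "past x = restrict (\<lambda>i. X i x) J" for x
  define C where "C = {\<phi> \<in> PiE J (\<lambda>_. S). f \<phi> \<in> space N}"
  obtain z where z: "z \<in> space N"
    using measurable_space[OF Z(1)] not_empty by blast
  define f' where "f' \<phi> = (if \<phi> \<in> C then f \<phi> else z)" for \<phi>
  have "countable C"
    unfolding C_def using J(1) S(1) by (intro countable_subset[OF _ countable_PiE]) auto
  then have f': "f' \<in> measurable (PiM J (\<lambda>_. count_space UNIV)) N"
    unfolding f'_def using J(1) z
    by (intro measurable_If_countable sets_PiM_count_space_singleton) (auto simp: C_def PiE_def)
  have "indep_var N (f' \<circ> past) L ((\<lambda>\<phi>. g (\<phi> k)) \<circ> (\<lambda>x. restrict (\<lambda>i. X i x) {k}))"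
    unfolding past_def using J k g
    by (intro indep_var_compose[OF indep_var_restrict[OF indep]] f'
          measurable_compose[OF measurable_component_singleton]) auto
  then have indep': "indep_var N (f' \<circ> past) L (\<lambda>x. g (X k x))"
    by (simp add: comp_def)
  have "AE x in M. \<forall>i\<in>J. X i x \<in> S"
    using J(1) S(2) by (intro AE_finite_allI)
  then have "AE x in M. (f' \<circ> past) x = Z x"
    using Z(2) AE_space
  proof eventually_elim
    case (elim x)
    then have "past x \<in> C"
      using measurable_space[OF Z(1), of x] by (auto simp: C_def past_def)
    then show ?case using elim(2) by (simp add: f'_def past_def)
  qed
  then show ?thesis
    using Z(1) indep_var_rv2[OF indep'] by (intro indep_var_cong_AE[OF indep']) auto
qed

section \<open>The Bernstein radius\<close>

text \<open>The larger root \<open>r\<close> of \<open>r\<^sup>2 = 2 l (V + c r / 3)\<close>, at which Bernstein's bound equals \<open>exp (- l)\<close>.\<close>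

definition bernstein_radius :: "real \<Rightarrow> real \<Rightarrow> real \<Rightarrow> real" where
  "bernstein_radius c V l = l * c / 3 + sqrt ((l * c / 3)\<^sup>2 + 2 * l * V)"

lemma bernstein_radius_pos:
  assumes "0 < l" "0 < c" "0 \<le> V"
  shows "0 < bernstein_radius c V l"
  unfolding bernstein_radius_def using assms by (intro add_pos_nonneg) auto

lemma bernstein_radius_power2:
  assumes "0 \<le> l" "0 \<le> V"
  shows "(bernstein_radius c V l)\<^sup>2 = 2 * l * (V + c * bernstein_radius c V l / 3)"
proof -
  let ?q = "sqrt ((l * c / 3)\<^sup>2 + 2 * l * V)"
  have "?q\<^sup>2 = (l * c / 3)\<^sup>2 + 2 * l * V" using assms by simp
  then show ?thesis unfolding bernstein_radius_def power2_sum
    by (simp add: field_simps power2_eq_square)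
qed

lemma bernstein_radius_leD:
  assumes "0 \<le> l" "0 \<le> V" "bernstein_radius c V l \<le> d"
  shows "0 \<le> d" and "2 * l * (V + c * d / 3) \<le> d\<^sup>2"
proof -
  let ?q = "sqrt ((l * c / 3)\<^sup>2 + 2 * l * V)"
  have sqrt_le: "?q \<le> d - l * c / 3" using assms(3) by (simp add: bernstein_radius_def)
  have "\<bar>l * c / 3\<bar> \<le> ?q" using assms(1,2) by (intro real_le_rsqrt) (simp add: power_divide)
  then show "0 \<le> d" using sqrt_le by linarith
  have "(l * c / 3)\<^sup>2 + 2 * l * V \<le> (d - l * c / 3)\<^sup>2" using sqrt_le by (rule sqrt_le_D)
  then show "2 * l * (V + c * d / 3) \<le> d\<^sup>2" by (simp add: power2_eq_square field_simps)
qed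

lemma bernstein_radius_leI:
  assumes "0 < l" "0 < V" "0 \<le> d" "2 * l * (V + c * d / 3) \<le> d\<^sup>2"
  shows "bernstein_radius c V l \<le> d"
proof -
  let ?q = "sqrt ((l * c / 3)\<^sup>2 + 2 * l * V)"
  have "(l * c / 3)\<^sup>2 + 2 * l * V \<le> (d - l * c / 3)\<^sup>2"
    using assms(4) by (simp add: power2_eq_square field_simps)
  then have "?q \<le> \<bar>d - l * c / 3\<bar>" using real_sqrt_le_mono by fastforce
  moreover have "\<bar>l * c / 3\<bar> < ?q"
    using assms(1,2) by (intro real_less_rsqrt) (simp add: power_divide)
  ultimately show ?thesis using assms(3) unfolding bernstein_radius_def by linarith
qed

lemma bernstein_radius_le_shift:
  assumes "0 < l" "0 < V" "0 \<le> V + h * d" "bernstein_radius (c - 3 * h) (V + h * d) l \<le> d"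
  shows "bernstein_radius c V l \<le> d"
proof (rule bernstein_radius_leI)
  have "V + h * d + (c - 3 * h) * d / 3 = V + c * d / 3" by (simp add: field_simps)
  then show "0 \<le> d" "2 * l * (V + c * d / 3) \<le> d\<^sup>2"
    using bernstein_radius_leD[OF less_imp_le[OF assms(1)] assms(3,4)] by (simp_all only:)
qed (use assms in auto)

lemma bernstein_radius_factored:
  assumes "0 < l"
  shows "bernstein_radius c V l = l * (c / 3 + sqrt ((c / 3)\<^sup>2 + 2 * V / l))"
proof -
  have "(l * c / 3)\<^sup>2 + 2 * l * V = l\<^sup>2 * ((c / 3)\<^sup>2 + 2 * V / l)"
    using assms by (simp add: field_simps power2_eq_square)
  then have "sqrt ((l * c / 3)\<^sup>2 + 2 * l * V) = l * sqrt ((c / 3)\<^sup>2 + 2 * V / l)"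
    using assms by (simp only: real_sqrt_mult) simp
  then show ?thesis by (simp add: bernstein_radius_def distrib_left)
qed

lemma lower_dev_eq_bernstein_radius:
  assumes "0 < k" "0 < \<delta>" "\<delta> < 1"
  shows "real k * lower_dev b \<delta> \<omega> k = bernstein_radius (1 - 3 * (\<omega> / k)) (\<omega> * b) (ln (1 / \<delta>))"
  using assms
  by (simp add: lower_dev_def bernstein_radius_factored diff_divide_distrib mult.commute
      mult.left_commute)

lemma upper_dev_eq_bernstein_radius:
  assumes "0 < k" "0 < \<delta>" "\<delta> < 1"
  shows "real k * upper_dev b \<delta> \<omega> k = bernstein_radius (1 + 3 * (\<omega> / k)) (\<omega> * b) (ln (1 / \<delta>))"
  using assms
  by (simp add: upper_dev_def bernstein_radius_factored add_divide_distrib mult.commute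
      mult.left_commute)

lemma upper_dev_pos:
  assumes "0 < k" "0 < \<delta>" "\<delta> < 1" "0 < \<omega>" "0 \<le> b"
  shows "0 < upper_dev b \<delta> \<omega> k"
proof -
  have "0 < real k * upper_dev b \<delta> \<omega> k"
    unfolding upper_dev_eq_bernstein_radius[OF assms(1-3)]
    using assms by (intro bernstein_radius_pos) (auto simp: add_pos_pos)
  then show ?thesis by (simp add: zero_less_mult_iff)
qed

lemma bernstein_radius_le_if_ge_lower_dev:
  assumes k: "0 < k" and \<delta>: "0 < \<delta>" "\<delta> < 1" and "0 < \<omega>" "0 < p" "0 \<le> b"
    and dev: "p \<le> b - lower_dev b \<delta> \<omega> k"
  shows "bernstein_radius 1 (\<omega> * p) (ln (1 / \<delta>)) \<le> real k * (b - p)"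
proof (rule bernstein_radius_le_shift[where h = "\<omega> / k"])
  have V: "\<omega> * p + \<omega> / k * (real k * (b - p)) = \<omega> * b"
    using k by (simp add: field_simps)
  show "0 \<le> \<omega> * p + \<omega> / k * (real k * (b - p))"
    unfolding V using assms by simp
  show "bernstein_radius (1 - 3 * (\<omega> / k)) (\<omega> * p + \<omega> / k * (real k * (b - p))) (ln (1 / \<delta>))
      \<le> real k * (b - p)"
    unfolding V lower_dev_eq_bernstein_radius[OF k \<delta>, symmetric]
    using dev by (intro mult_left_mono) auto
qed (use assms in auto)

lemma bernstein_radius_le_if_ge_upper_dev:
  assumes k: "0 < k" and \<delta>: "0 < \<delta>" "\<delta> < 1" and "0 < \<omega>" "0 < p" "0 \<le> b"
    and dev: "b + upper_dev b \<delta> \<omega> k \<le> p"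
  shows "bernstein_radius 1 (\<omega> * p) (ln (1 / \<delta>)) \<le> real k * (p - b)"
proof (rule bernstein_radius_le_shift[where h = "- (\<omega> / k)"])
  have V: "\<omega> * p + - (\<omega> / k) * (real k * (p - b)) = \<omega> * b"
    using k by (simp add: field_simps)
  show "0 \<le> \<omega> * p + - (\<omega> / k) * (real k * (p - b))"
    unfolding V using assms by simp
  show "bernstein_radius (1 - 3 * - (\<omega> / k)) (\<omega> * p + - (\<omega> / k) * (real k * (p - b))) (ln (1 / \<delta>))
      \<le> real k * (p - b)"
    unfolding V mult_minus_right diff_minus_eq_add upper_dev_eq_bernstein_radius[OF k \<delta>, symmetric]
    using dev by (intro mult_left_mono) auto
qed (use assms in auto)

section \<open>Bernstein's inequality at a stopping time\<close>

locale stopped_sum = prob_space M for M :: "'w measure" +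
  fixes Y :: "nat \<Rightarrow> 'w \<Rightarrow> real" and \<tau> :: "'w \<Rightarrow> nat" and c :: real
  assumes increment_bounded: "\<And>i x. 1 \<le> i \<Longrightarrow> x \<in> space M \<Longrightarrow> \<bar>Y i x\<bar> \<le> c"
    and time_measurable [measurable]: "\<tau> \<in> measurable M (count_space UNIV)"
    and increment_indep_past: "\<And>n f. f \<in> borel_measurable borel \<Longrightarrow>
      indep_var borel (\<lambda>x. of_bool (n < \<tau> x) * f (\<Sum>i=1..n. Y i x)) borel (Y (Suc n))"
begin

lemma increment_bound_nonneg: "0 \<le> c"
proof -
  obtain x where "x \<in> space M" using not_empty by blast
  then show ?thesis using increment_bounded[of 1 x] by force
qed

lemma increment_measurable: "1 \<le> i \<Longrightarrow> random_variable borel (Y i)"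
  using indep_var_rv2[OF increment_indep_past[of "\<lambda>_. 0" "i - 1"]] by simp

lemma partial_sum_measurable [measurable]: "random_variable borel (\<lambda>x. \<Sum>i=1..n. Y i x)"
  by (intro borel_measurable_sum increment_measurable) simp

lemma stopped_sum_measurable [measurable]: "random_variable borel (\<lambda>x. \<Sum>i=1..\<tau> x. Y i x)"
  by (rule measurable_compose_countable[where f = "\<lambda>n x. \<Sum>i=1..n. Y i x"]) measurable

lemma abs_partial_sum_le:
  assumes "x \<in> space M"
  shows "\<bar>\<Sum>i=1..n. Y i x\<bar> \<le> real n * c"
proof -
  have "\<bar>\<Sum>i=1..n. Y i x\<bar> \<le> (\<Sum>i=1..n. \<bar>Y i x\<bar>)" by (rule sum_abs)
  also have "\<dots> \<le> of_nat (card {1..n}) * c"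
    using assms by (intro sum_bounded_above increment_bounded) auto
  finally show ?thesis by simp
qed

definition exp_process :: "real \<Rightarrow> real \<Rightarrow> nat \<Rightarrow> 'w \<Rightarrow> real" where
  "exp_process \<theta> \<kappa> n x = exp (\<theta> * (\<Sum>i=1..n. Y i x) - real n * \<kappa>)"

lemma exp_process_measurable [measurable]: "random_variable borel (exp_process \<theta> \<kappa> n)"
  unfolding exp_process_def by measurable

lemma exp_process_Suc:
  "exp_process \<theta> \<kappa> (Suc n) x = exp_process \<theta> \<kappa> n x * exp (\<theta> * Y (Suc n) x - \<kappa>)"
  by (simp add: exp_process_def flip: exp_add) (simp add: algebra_simps)

lemma exp_process_le:
  assumes "x \<in> space M" "m \<le> n"
  shows "exp_process \<theta> \<kappa> m x \<le> exp (real n * (\<bar>\<theta>\<bar> * c + \<bar>\<kappa>\<bar>))"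
proof -
  have "\<theta> * (\<Sum>i=1..m. Y i x) \<le> \<bar>\<theta>\<bar> * \<bar>\<Sum>i=1..m. Y i x\<bar>"
    by (simp flip: abs_mult)
  also have "\<dots> \<le> \<bar>\<theta>\<bar> * (real m * c)"
    by (intro mult_left_mono abs_partial_sum_le assms(1)) simp
  finally have "\<theta> * (\<Sum>i=1..m. Y i x) \<le> \<bar>\<theta>\<bar> * (real m * c)" .
  moreover have "real m * - \<kappa> \<le> real m * \<bar>\<kappa>\<bar>"
    by (intro mult_left_mono abs_ge_minus_self) simp
  ultimately have "\<theta> * (\<Sum>i=1..m. Y i x) - real m * \<kappa> \<le> real m * (\<bar>\<theta>\<bar> * c + \<bar>\<kappa>\<bar>)"
    by (simp add: algebra_simps)
  also have "\<dots> \<le> real n * (\<bar>\<theta>\<bar> * c + \<bar>\<kappa>\<bar>)"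
    using assms(2) increment_bound_nonneg by (intro mult_right_mono) auto
  finally show ?thesis by (simp add: exp_process_def)
qed

lemma integrable_stopped_exp_process:
  "integrable M (\<lambda>x. exp_process \<theta> \<kappa> (min n (\<tau> x)) x)"
proof (rule integrable_const_bound[OF AE_I2])
  show "norm (exp_process \<theta> \<kappa> (min n (\<tau> x)) x) \<le> exp (real n * (\<bar>\<theta>\<bar> * c + \<bar>\<kappa>\<bar>))"
    if "x \<in> space M" for x
    using exp_process_le[OF that, of "min n (\<tau> x)" n] by (simp add: exp_process_def)
  show "random_variable borel (\<lambda>x. exp_process \<theta> \<kappa> (min n (\<tau> x)) x)"
    by (rule measurable_compose_countable[where f = "exp_process \<theta> \<kappa>" and g = "\<lambda>x. min n (\<tau> x)"])
      measurable
qed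

lemma integrable_exp_increment:
  assumes "1 \<le> i"
  shows "integrable M (\<lambda>x. exp (\<theta> * Y i x - \<kappa>))"
proof (rule integrable_const_bound[OF AE_I2])
  note [measurable] = increment_measurable[OF assms]
  show "random_variable borel (\<lambda>x. exp (\<theta> * Y i x - \<kappa>))" by measurable
  fix x assume "x \<in> space M"
  then have "\<bar>\<theta> * Y i x\<bar> \<le> \<bar>\<theta>\<bar> * c"
    using increment_bounded[OF assms] by (simp add: abs_mult mult_left_mono)
  then show "norm (exp (\<theta> * Y i x - \<kappa>)) \<le> exp (\<bar>\<theta>\<bar> * c - \<kappa>)" by simp
qed

lemma integrable_running_exp_process:
  "integrable M (\<lambda>x. of_bool (n < \<tau> x) * exp_process \<theta> \<kappa> n x)"
proof (rule integrable_const_bound[OF AE_I2])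
  show "norm (of_bool (n < \<tau> x) * exp_process \<theta> \<kappa> n x) \<le> exp (real n * (\<bar>\<theta>\<bar> * c + \<bar>\<kappa>\<bar>))"
    if "x \<in> space M" for x
    using exp_process_le[OF that order_refl, of \<theta> \<kappa> n] by (simp add: exp_process_def)
qed measurable

lemma running_exp_process_indep_increment:
  "indep_var borel (\<lambda>x. of_bool (n < \<tau> x) * exp_process \<theta> \<kappa> n x)
     borel (\<lambda>x. exp (\<theta> * Y (Suc n) x - \<kappa>))"
proof -
  have "indep_var
      borel ((\<lambda>z. z) \<circ> (\<lambda>x. of_bool (n < \<tau> x) * exp (\<theta> * (\<Sum>i=1..n. Y i x) - real n * \<kappa>)))
      borel ((\<lambda>y. exp (\<theta> * y - \<kappa>)) \<circ> Y (Suc n))"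
    by (intro indep_var_compose[OF increment_indep_past]) measurable
  then show ?thesis by (simp only: comp_def exp_process_def)
qed

lemma stopped_exp_process_Suc:
  "exp_process \<theta> \<kappa> (min (Suc n) (\<tau> x)) x = exp_process \<theta> \<kappa> (min n (\<tau> x)) x +
     of_bool (n < \<tau> x) * exp_process \<theta> \<kappa> n x * (exp (\<theta> * Y (Suc n) x - \<kappa>) - 1)"
  by (cases "n < \<tau> x") (simp_all add: exp_process_Suc min_def not_less right_diff_distrib)

lemma expectation_stopped_exp_process_le_1:
  assumes mgf: "\<And>i. 1 \<le> i \<Longrightarrow> expectation (\<lambda>x. exp (\<theta> * Y i x)) \<le> exp \<kappa>"
  shows "expectation (\<lambda>x. exp_process \<theta> \<kappa> (min n (\<tau> x)) x) \<le> 1"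
proof (induction n)
  case 0
  then show ?case by (simp add: exp_process_def prob_space)
next
  case (Suc n)
  let ?stopped = "\<lambda>n x. exp_process \<theta> \<kappa> (min n (\<tau> x)) x"
  let ?running = "\<lambda>x. of_bool (n < \<tau> x) * exp_process \<theta> \<kappa> n x"
  let ?factor = "\<lambda>x. exp (\<theta> * Y (Suc n) x - \<kappa>)"
  have factor: "integrable M ?factor" by (rule integrable_exp_increment) simp
  have factor_le: "expectation ?factor \<le> 1"
    using mgf[of "Suc n"] by (simp add: exp_diff)
  note indep = running_exp_process_indep_increment[of n \<theta> \<kappa>]
  note running = integrable_running_exp_process[of n \<theta> \<kappa>]
  have "expectation (?stopped (Suc n))
      = expectation (\<lambda>x. ?stopped n x + (?running x * ?factor x - ?running x))"
    by (simp add: stopped_exp_process_Suc right_diff_distrib)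
  also have "\<dots> = expectation (?stopped n)
      + (expectation ?running * expectation ?factor - expectation ?running)"
    using integrable_stopped_exp_process[of \<theta> \<kappa> n] running
      indep_var_integrable[OF indep running factor]
    by (simp only: Bochner_Integration.integral_add Bochner_Integration.integral_diff
        Bochner_Integration.integrable_diff indep_var_lebesgue_integral[OF indep running factor])
  also have "\<dots> \<le> expectation (?stopped n)"
    using mult_left_mono[OF factor_le, of "expectation ?running"]
    by (simp add: exp_process_def)
  also have "\<dots> \<le> 1" by (rule Suc)
  finally show ?case .
qed

lemma bernstein_inequality_stopped_sum:
  assumes mean: "\<And>i. 1 \<le> i \<Longrightarrow> expectation (Y i) = 0"
    and second_moment: "\<And>i. 1 \<le> i \<Longrightarrow> expectation (\<lambda>x. (Y i x)\<^sup>2) \<le> s"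
    and time_le: "\<And>x. x \<in> space M \<Longrightarrow> real (\<tau> x) \<le> \<omega>"
    and pos: "0 < s" "0 < \<omega>" "0 \<le> r"
  shows "prob {x \<in> space M. r \<le> (\<Sum>i=1..\<tau> x. Y i x)} \<le> exp (- (r\<^sup>2 / (2 * (\<omega> * s + c * r / 3))))"
    (is "_ \<le> exp (- ?e)")
proof -
  define \<theta> where "\<theta> = r / (\<omega> * s + c * r / 3)"
  define \<kappa> where "\<kappa> = s * bernstein_cgf c \<theta>"
  define n where "n = nat \<lfloor>\<omega>\<rfloor>"
  let ?stopped = "\<lambda>x. exp_process \<theta> \<kappa> (min n (\<tau> x)) x"
  have "0 < \<omega> * s" using pos by simp
  note \<theta> = bernstein_exponent_eq[OF this increment_bound_nonneg pos(3), folded \<theta>_def]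
  have \<kappa>: "0 \<le> \<kappa>" using bernstein_cgf_nonneg[OF \<theta>(2)] pos(1) by (simp add: \<kappa>_def)
  have mgf: "expectation (\<lambda>x. exp (\<theta> * Y i x)) \<le> exp \<kappa>" if "1 \<le> i" for i
    unfolding \<kappa>_def using that \<theta>(1,2) increment_bounded
    by (intro expectation_exp_le_bernstein_cgf increment_measurable mean second_moment) auto
  have exceeds: "exp ?e \<le> ?stopped x" if x: "x \<in> space M" and r: "r \<le> (\<Sum>i=1..\<tau> x. Y i x)" for x
  proof -
    have "?e = \<theta> * r - \<omega> * \<kappa>" using \<theta>(3) by (simp only: \<kappa>_def mult.assoc)
    also have "\<dots> \<le> \<theta> * (\<Sum>i=1..\<tau> x. Y i x) - real (\<tau> x) * \<kappa>"
      using r time_le[OF x] \<theta>(1) \<kappa> by (intro diff_mono mult_left_mono mult_right_mono)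
    finally have "exp ?e \<le> exp_process \<theta> \<kappa> (\<tau> x) x"
      by (simp only: exp_process_def exp_le_cancel_iff)
    moreover have "min n (\<tau> x) = \<tau> x"
      using time_le[OF x] by (simp add: n_def le_nat_floor min_absorb2)
    ultimately show ?thesis by (simp only:)
  qed
  have int: "integrable M ?stopped" by (rule integrable_stopped_exp_process)
  have "prob {x \<in> space M. r \<le> (\<Sum>i=1..\<tau> x. Y i x)} \<le> prob {x \<in> space M. exp ?e \<le> ?stopped x}"
    using exceeds borel_measurable_integrable[OF int] by (intro finite_measure_mono) auto
  also have "\<dots> \<le> expectation ?stopped / exp ?e"
    by (rule integral_Markov_inequality_measure[OF int, of "{}"]) (auto simp: exp_process_def)
  also have "\<dots> \<le> 1 / exp ?e"
    by (intro divide_right_mono expectation_stopped_exp_process_le_1 mgf) auto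
  finally show ?thesis by (simp add: exp_minus inverse_eq_divide)
qed

lemma stopped_sum_bernstein_radius_tail:
  assumes "\<And>i. 1 \<le> i \<Longrightarrow> expectation (Y i) = 0"
    and "\<And>i. 1 \<le> i \<Longrightarrow> expectation (\<lambda>x. (Y i x)\<^sup>2) \<le> s"
    and "\<And>x. x \<in> space M \<Longrightarrow> real (\<tau> x) \<le> \<omega>"
    and pos: "0 < s" "0 < \<omega>" "0 < c" and \<delta>: "0 < \<delta>" "\<delta> < 1"
  shows "prob {x \<in> space M. bernstein_radius c (\<omega> * s) (ln (1 / \<delta>)) \<le> (\<Sum>i=1..\<tau> x. Y i x)} \<le> \<delta>"
proof -
  define l where "l = ln (1 / \<delta>)"
  have l: "0 < l" using \<delta> by (simp add: l_def)
  define r where "r = bernstein_radius c (\<omega> * s) l"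
  have r: "0 < r" using pos l by (simp add: r_def bernstein_radius_pos)
  have "prob {x \<in> space M. r \<le> (\<Sum>i=1..\<tau> x. Y i x)} \<le> exp (- (r\<^sup>2 / (2 * (\<omega> * s + c * r / 3))))"
    using assms r by (intro bernstein_inequality_stopped_sum) auto
  also have "r\<^sup>2 / (2 * (\<omega> * s + c * r / 3)) = l"
  proof -
    have "0 < \<omega> * s + c * r / 3" using pos r by (simp add: add_pos_pos)
    moreover have "r\<^sup>2 = l * (2 * (\<omega> * s + c * r / 3))"
      using bernstein_radius_power2[of l "\<omega> * s" c] pos l by (simp add: r_def)
    ultimately show ?thesis by simp
  qed
  also have "exp (- l) = \<delta>" using \<delta> by (simp add: l_def ln_div)
  finally show ?thesis by (simp only: r_def l_def)
qed

end

section \<open>Sample means at a stopping time\<close>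

locale stopped_sampling = prob_space M for M :: "'w measure" +
  fixes X :: "nat \<Rightarrow> 'w \<Rightarrow> 'c" and P :: "'c pmf" and u :: "'c \<Rightarrow> real"
    and \<tau> :: "'w \<Rightarrow> nat" and \<omega> :: real
  assumes sample_indep: "indep_vars (\<lambda>_. count_space UNIV) X {1..}"
    and sample_distr: "\<And>i. 1 \<le> i \<Longrightarrow> distr M (count_space UNIV) (X i) = measure_pmf P"
    and unit_valued: "\<And>q. 0 \<le> u q \<and> u q \<le> 1"
    and time_measurable [measurable]: "\<tau> \<in> measurable M (count_space UNIV)"
    and time_pos: "\<And>x. x \<in> space M \<Longrightarrow> 0 < \<tau> x"
    and time_le: "\<And>x. x \<in> space M \<Longrightarrow> real (\<tau> x) \<le> \<omega>"
    and time_determined: "\<And>t. \<exists>D. \<forall>x \<in> space M. \<tau> x = t \<longleftrightarrow> map (\<lambda>i. X i x) [1..<Suc t] \<in> D"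
begin

abbreviation mean :: real where
  "mean \<equiv> measure_pmf.expectation P u"

definition sample_mean :: "'w \<Rightarrow> real" where
  "sample_mean x = 1 / real (\<tau> x) * (\<Sum>i=1..\<tau> x. u (X i x))"

lemma sample_measurable: "1 \<le> i \<Longrightarrow> X i \<in> measurable M (count_space UNIV)"
  using sample_indep by (auto simp: indep_vars_def)

lemma function_of_sample_measurable: "1 \<le> i \<Longrightarrow> random_variable borel (\<lambda>x. g (X i x))"
  by (rule measurable_compose[OF sample_measurable]) simp_all

lemma AE_sample_in_set_pmf:
  assumes "1 \<le> i"
  shows "AE x in M. X i x \<in> set_pmf P"
proof -
  have "AE q in distr M (count_space UNIV) (X i). q \<in> set_pmf P"
    unfolding sample_distr[OF assms] by (rule AE_measure_pmf)
  then show ?thesis by (subst (asm) AE_distr_iff) (use sample_measurable[OF assms] in auto)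
qed

lemma expectation_function_of_sample:
  fixes g :: "'c \<Rightarrow> real"
  assumes "1 \<le> i"
  shows "expectation (\<lambda>x. g (X i x)) = measure_pmf.expectation P g"
  using integral_distr[OF sample_measurable[OF assms], of g]
  by (simp add: sample_distr[OF assms])

lemma running_determined_by_past:
  obtains A where "\<And>x. x \<in> space M \<Longrightarrow> n < \<tau> x \<longleftrightarrow> restrict (\<lambda>i. X i x) {1..n} \<in> A"
proof -
  obtain D where D: "\<And>t x. x \<in> space M \<Longrightarrow> \<tau> x = t \<longleftrightarrow> map (\<lambda>i. X i x) [1..<Suc t] \<in> D t"
    using time_determined by metis
  have "n < \<tau> x \<longleftrightarrow> (\<forall>t\<le>n. map (restrict (\<lambda>i. X i x) {1..n}) [1..<Suc t] \<notin> D t)"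
    if x: "x \<in> space M" for x
  proof -
    have "map (restrict (\<lambda>i. X i x) {1..n}) [1..<Suc t] = map (\<lambda>i. X i x) [1..<Suc t]"
      if "t \<le> n" for t using that by auto
    then have "(\<forall>t\<le>n. map (restrict (\<lambda>i. X i x) {1..n}) [1..<Suc t] \<notin> D t) \<longleftrightarrow> (\<forall>t\<le>n. \<tau> x \<noteq> t)"
      using D[OF x] by metis
    then show ?thesis by (auto simp: not_le[symmetric])
  qed
  then show thesis by (intro that[of "{\<phi>. \<forall>t\<le>n. map \<phi> [1..<Suc t] \<notin> D t}"]) simp
qed

lemma stopped_sum_of_samples:
  assumes "\<And>q. \<bar>g q\<bar> \<le> c"
  shows "stopped_sum M (\<lambda>i x. g (X i x)) \<tau> c"
proof unfold_locales
  fix n and f :: "real \<Rightarrow> real"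
  assume f [measurable]: "f \<in> borel_measurable borel"
  obtain A where A: "\<And>x. x \<in> space M \<Longrightarrow> n < \<tau> x \<longleftrightarrow> restrict (\<lambda>i. X i x) {1..n} \<in> A"
    using running_determined_by_past by blast
  have [measurable]: "random_variable borel (\<lambda>x. \<Sum>i=1..n. g (X i x))"
    by (intro borel_measurable_sum function_of_sample_measurable) simp
  show "indep_var borel (\<lambda>x. of_bool (n < \<tau> x) * f (\<Sum>i=1..n. g (X i x)))
      borel (\<lambda>x. g (X (Suc n) x))"
  proof (rule indep_var_function_of_countable_past[OF sample_indep, where S = "set_pmf P"])
    show "AE x in M. of_bool (n < \<tau> x) * f (\<Sum>i=1..n. g (X i x))
        = (\<lambda>\<phi>. of_bool (\<phi> \<in> A) * f (\<Sum>i=1..n. g (\<phi> i))) (restrict (\<lambda>i. X i x) {1..n})"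
      using A by (intro AE_I2) simp
    show "AE x in M. X i x \<in> set_pmf P" if "i \<in> {1..n}" for i
      using that by (intro AE_sample_in_set_pmf) simp
    show "random_variable borel (\<lambda>x. of_bool (n < \<tau> x) * f (\<Sum>i=1..n. g (X i x)))" by measurable
  qed auto
qed (use assms time_measurable in auto)

lemma mean_unit: "0 \<le> mean" "mean \<le> 1"
proof -
  have u: "integrable P u"
    using unit_valued by (intro measure_pmf.integrable_const_bound[where B = 1]) auto
  show "0 \<le> mean" using unit_valued by simp
  show "mean \<le> 1"
    using unit_valued by (intro measure_pmf.integral_le_const[OF u]) auto
qed

sublocale excess: stopped_sum M "\<lambda>i x. u (X i x) - mean" \<tau> 1
  using mean_unit unit_valued
  by (intro stopped_sum_of_samples[of "\<lambda>q. u q - mean"])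
    (simp add: abs_le_iff add_increasing2 algebra_simps)

sublocale deficit: stopped_sum M "\<lambda>i x. mean - u (X i x)" \<tau> 1
  using mean_unit unit_valued
  by (intro stopped_sum_of_samples[of "\<lambda>q. mean - u q"])
    (simp add: abs_le_iff add_increasing2 algebra_simps)

lemma integrable_unit_sample: "1 \<le> i \<Longrightarrow> integrable M (\<lambda>x. u (X i x))"
  using unit_valued function_of_sample_measurable
  by (intro integrable_const_bound[where B = 1]) auto

lemma second_moment_centered_sample_le:
  assumes "1 \<le> i"
  shows "expectation (\<lambda>x. (u (X i x) - mean)\<^sup>2) \<le> mean"
  using variance_unit_interval_le[OF function_of_sample_measurable[OF assms, of u]] unit_valued
  by (simp add: expectation_function_of_sample[OF assms])

lemma time_bound_pos: "0 < \<omega>"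
proof -
  obtain x where "x \<in> space M" using not_empty by blast
  then show ?thesis using time_pos[of x] time_le[of x] by simp
qed

lemma excess_tail:
  assumes "0 < mean" "0 < \<delta>" "\<delta> < 1"
  shows "prob {x \<in> space M.
    bernstein_radius 1 (\<omega> * mean) (ln (1 / \<delta>)) \<le> (\<Sum>i=1..\<tau> x. u (X i x) - mean)} \<le> \<delta>"
  using assms time_bound_pos time_le second_moment_centered_sample_le integrable_unit_sample
  by (intro excess.stopped_sum_bernstein_radius_tail)
    (simp_all add: expectation_function_of_sample prob_space)

lemma deficit_tail:
  assumes "0 < mean" "0 < \<delta>" "\<delta> < 1"
  shows "prob {x \<in> space M.
    bernstein_radius 1 (\<omega> * mean) (ln (1 / \<delta>)) \<le> (\<Sum>i=1..\<tau> x. mean - u (X i x))} \<le> \<delta>"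
  using assms time_bound_pos time_le second_moment_centered_sample_le integrable_unit_sample
  by (intro deficit.stopped_sum_bernstein_radius_tail)
    (simp_all add: expectation_function_of_sample prob_space power2_commute[of mean])

lemma sample_mean_nonneg: "0 \<le> sample_mean x"
  using unit_valued by (simp add: sample_mean_def sum_nonneg)

lemma sum_excess_eq:
  "x \<in> space M \<Longrightarrow> (\<Sum>i=1..\<tau> x. u (X i x) - mean) = real (\<tau> x) * (sample_mean x - mean)"
  using time_pos[of x] by (simp add: sample_mean_def sum_subtractf right_diff_distrib)

lemma sum_deficit_eq:
  "x \<in> space M \<Longrightarrow> (\<Sum>i=1..\<tau> x. mean - u (X i x)) = real (\<tau> x) * (mean - sample_mean x)"
  using time_pos[of x] by (simp add: sample_mean_def sum_subtractf right_diff_distrib)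

theorem sample_mean_lower_tail:
  assumes "0 < mean" "0 < \<delta>" "\<delta> < 1"
  shows "prob {x \<in> space M. mean \<le> sample_mean x - lower_dev (sample_mean x) \<delta> \<omega> (\<tau> x)} \<le> \<delta>"
    (is "prob ?E \<le> _")
proof -
  have "prob ?E \<le> prob {x \<in> space M.
      bernstein_radius 1 (\<omega> * mean) (ln (1 / \<delta>)) \<le> (\<Sum>i=1..\<tau> x. u (X i x) - mean)}"
    (is "_ \<le> prob ?D")
  proof (rule finite_measure_mono)
    show "?E \<subseteq> ?D"
    proof safe
      fix x assume "x \<in> space M" "mean \<le> sample_mean x - lower_dev (sample_mean x) \<delta> \<omega> (\<tau> x)"
      then show "bernstein_radius 1 (\<omega> * mean) (ln (1 / \<delta>)) \<le> (\<Sum>i=1..\<tau> x. u (X i x) - mean)"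
        using assms time_pos[of x] time_bound_pos sample_mean_nonneg[of x]
        by (subst sum_excess_eq) (auto intro: bernstein_radius_le_if_ge_lower_dev simp del: ln_div)
    qed
    show "?D \<in> events" by measurable
  qed
  also have "\<dots> \<le> \<delta>" using assms by (rule excess_tail)
  finally show ?thesis .
qed

theorem sample_mean_upper_tail:
  assumes \<delta>: "0 < \<delta>" "\<delta> < 1"
  shows "prob {x \<in> space M. mean \<ge> sample_mean x + upper_dev (sample_mean x) \<delta> \<omega> (\<tau> x)} \<le> \<delta>"
    (is "prob ?E \<le> _")
proof (cases "0 < mean")
  case True
  have "prob ?E \<le> prob {x \<in> space M.
      bernstein_radius 1 (\<omega> * mean) (ln (1 / \<delta>)) \<le> (\<Sum>i=1..\<tau> x. mean - u (X i x))}"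
    (is "_ \<le> prob ?D")
  proof (rule finite_measure_mono)
    show "?E \<subseteq> ?D"
    proof safe
      fix x assume "x \<in> space M" "mean \<ge> sample_mean x + upper_dev (sample_mean x) \<delta> \<omega> (\<tau> x)"
      then show "bernstein_radius 1 (\<omega> * mean) (ln (1 / \<delta>)) \<le> (\<Sum>i=1..\<tau> x. mean - u (X i x))"
        using True \<delta> time_pos[of x] time_bound_pos sample_mean_nonneg[of x]
        by (subst sum_deficit_eq) (auto intro: bernstein_radius_le_if_ge_upper_dev simp del: ln_div)
    qed
    show "?D \<in> events" by measurable
  qed
  also have "\<dots> \<le> \<delta>" using True \<delta> by (rule deficit_tail)
  finally show ?thesis .
next
  case False
  have "0 < sample_mean x + upper_dev (sample_mean x) \<delta> \<omega> (\<tau> x)" if "x \<in> space M" for x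
    using that \<delta> time_pos time_bound_pos sample_mean_nonneg
    by (intro add_nonneg_pos upper_dev_pos) auto
  then have "?E = {}" using False by force
  then show ?thesis using \<delta> by (simp only: measure_empty less_imp_le)
qed

end

theorem theorem6:
  fixes G :: "('a, 'b) pre_digraph" and v :: 'a
    and M :: "'w measure" and \<pi> :: "nat \<Rightarrow> 'w \<Rightarrow> 'b awalk" and \<tau> :: "'w \<Rightarrow> nat"
    and \<omega> \<delta>\<^sub>L \<delta>\<^sub>U :: real
  assumes "digraph G" and "2 \<le> card (verts G)" and "v \<in> verts G"
    and "prob_space M"
    and "prob_space.indep_vars M (\<lambda>_. count_space UNIV) \<pi> {1..}"
    and "\<And>i. 1 \<le> i \<Longrightarrow> distr M (count_space UNIV) (\<pi> i) = measure_pmf (random_path G)"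
    and "0 < \<omega>"
    and "\<tau> \<in> measurable M (count_space UNIV)"
    and "\<And>x. x \<in> space M \<Longrightarrow> 0 < \<tau> x \<and> real (\<tau> x) \<le> \<omega>"
    and "\<And>t. \<exists>D. \<forall>x \<in> space M. \<tau> x = t \<longleftrightarrow> map (\<lambda>i. \<pi> i x) [1..<Suc t] \<in> D"
    and "0 < \<delta>\<^sub>L" and "\<delta>\<^sub>L < 1" and "0 < \<delta>\<^sub>U" and "\<delta>\<^sub>U < 1"
  defines "est \<equiv> \<lambda>x. empirical_betweenness G v (\<lambda>i. \<pi> i x) (\<tau> x)"
  shows "(0 < betweenness G v \<longrightarrow>
           measure M {x \<in> space M. betweenness G v \<le> est x - lower_dev (est x) \<delta>\<^sub>L \<omega> (\<tau> x)} \<le> \<delta>\<^sub>L) \<and>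
         measure M {x \<in> space M. betweenness G v \<ge> est x + upper_dev (est x) \<delta>\<^sub>U \<omega> (\<tau> x)} \<le> \<delta>\<^sub>U"
proof -
  interpret G: digraph G by fact
  interpret stopped_sampling M \<pi> "random_path G" "hit G v" \<tau> \<omega>
    using assms(5,6,8-10)
    by (intro stopped_sampling.intro[OF assms(4)] stopped_sampling_axioms.intro)
      (auto simp: hit_def)
  have mean: "mean = betweenness G v" by (rule G.expectation_hit[OF assms(2)])
  have est: "est = sample_mean"
    by (simp add: est_def fun_eq_iff empirical_betweenness_def sample_mean_def)
  show ?thesis
    using sample_mean_lower_tail[OF _ assms(11,12)] sample_mean_upper_tail[OF assms(13,14)]
    by (simp add: mean est)
qed

end
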